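(* Let $\{x^k\}_{k\in\mathbb{N}}$ be a sequence generated by the Augmented Lagrangian Method (described in the context) applied to (CTP), and let $\bar{x}\in L^\infty([0,T];\mathbb{R}^n)$ satisfy $x^k(t)\to\bar{x}(t)$ for a.e. $t\in[0,T]$. Assume that hypotheses (H1), (H2) (at $\bar{x}$) and (H3), stated in the context, are satisfied. In addition, assume: (H4) there exist $\delta>0$ and an integrable function $k_{\phi,h,g}$ on $[0,T]$ such that $$\|\nabla_x\phi(x,t)\|+\|\nabla_xh(x,t)\|+\|\nabla_xg(x,t)\|\le k_{\phi,h,g}(t)\quad\text{for all } x\in\bar{B}_\delta(t),\ \text{a.e. } t\in[0,T].$$ Then $\bar{x}$ is a stationary point for the problem of minimizing $$\Theta(x)=\int_0^T\Big[\sum_{i=1}^p[h_i(x(t),t)]^2+\sum_{j=1}^m[g_j^+(x(t),t)]^2\Big]dt$$ over $x\in L^\infty([0,T];\mathbb{R}^n)$, where $g_j^+(x,t)=\max\{g_j(x,t),0\}$; that is, the gradient with respect to $x$ of the integrand $\sum_{i=1}^p[h_i(x,t)]^2+\sum_{j=1}^m[g_j^+(x,t)]^2$ vanishes at $x=\bar{x}(t)$ for a.e. $t\in[0,T]$.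
   Context: Let $T>0$ and let $\phi:\mathbb{R}^n\times[0,T]\to\mathbb{R}$, $h=(h_1,\dots,h_p):\mathbb{R}^n\times[0,T]\to\mathbb{R}^p$, $g=(g_1,\dots,g_m):\mathbb{R}^n\times[0,T]\to\mathbb{R}^m$ be given functions. Integrals are Lebesgue integrals and vector inequalities are componentwise. Problem (CTP) is: minimize $P(x)=\int_0^T\phi(x(t),t)\,dt$ over $x\in L^\infty([0,T];\mathbb{R}^n)$ subject to $h(x(t),t)=0$ and $g(x(t),t)\le 0$ for a.e. $t\in[0,T]$. For $r>0$ put $\bar{B}_r(t)=\{x\in\mathbb{R}^n:\|x-\bar{x}(t)\|\le r\}$. (H1)–(H2) at $\bar{x}$: there exists $r>0$ such that: (H1) $\phi(\cdot,t)$ is continuously differentiable for a.e. $t\in[0,T]$; $\phi(x,\cdot)$ is Lebesgue measurable for each $x$; $|\phi(\bar{x}(\cdot),\cdot)|$ is integrable on $[0,T]$; there is an integrable function $c_\phi$ on $[0,T]$ with $|\phi(x,t)-\phi(y,t)|\le c_\phi(t)\|x-y\|$ for all $x,y\in\bar{B}_r(t)$, a.e. $t\in[0,T]$. (H2) $(h,g)(\cdot,t)$ is continuously differentiable for a.e. $t\in[0,T]$; $(h,g)(x,\cdot)$ is Lebesgue measurable for each $x$; $\|(h,g)(\bar{x}(\cdot),\cdot)\|$ is integrable on $[0,T]$; there is an integrable function $c_{h,g}$ on $[0,T]$ with $\|(h,g)(x,t)-(h,g)(y,t)\|\le c_{h,g}(t)\|x-y\|$ for all $x,y\in\bar{B}_r(t)$,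 a.e. $t\in[0,T]$. Stationarity: $\bar{x}\in L^\infty([0,T];\mathbb{R}^n)$ is a stationary point of the unconstrained problem of minimizing $\int_0^T\psi(x(t),t)\,dt$ over $x\in L^\infty([0,T];\mathbb{R}^n)$ when $\nabla_x\psi(\bar{x}(t),t)=0$ for a.e. $t\in[0,T]$. Augmented Lagrangian: for $\rho>0$, $$L_\rho(x,u,v,t)=\phi(x,t)+\frac{\rho}{2}\sum_{i=1}^p\Big[h_i(x,t)+\frac{u_i}{\rho}\Big]^2+\frac{\rho}{2}\sum_{j=1}^m\Big[\max\Big\{0,g_j(x,t)+\frac{v_j}{\rho}\Big\}\Big]^2 .$$ Augmented Lagrangian Method. Parameters: $M,N>0$, $\gamma>1$, $\rho_1>0$, $\tau\in(0,1)$. Initial data: $\tilde{u}^1\in L^\infty([0,T];\mathbb{R}^p)$ and $\tilde{v}^1\in L^\infty([0,T];\mathbb{R}^m_+)$ with $\tilde{u}^1_i(t)\in[-M,M]$ and $\tilde{v}^1_j(t)\in[0,N]$ for a.e. $t$ and all $i,j$; an arbitrary $x^0\in L^\infty([0,T];\mathbb{R}^n)$; $V^0_j(t)=\max\{g_j(x^0(t),t),0\}$ and $H^0(t)=h(x^0(t),t)$. For $k=1,2,\dots$: - Compute an approximate solution $x^k\in L^\infty([0,T];\mathbb{R}^n)$ of the problem of minimizing $\int_0^TL_{\rho_k}(x(t),\tilde{u}^k(t),\tilde{v}^k(t),t)\,dt$ over $x\in L^\infty([0,T];\mathbb{R}^n)$; the meaning of "approximate solution" is given by (H3) below. - Define $V^k\in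 L^\infty([0,T];\mathbb{R}^m)$ and $H^k\in L^\infty([0,T];\mathbb{R}^p)$ by $V^k_j(t)=\max\{g_j(x^k(t),t),-\tilde{v}^k_j(t)/\rho_k\}$ and $H^k(t)=h(x^k(t),t)$ (these are understood to be essentially bounded). If $\max\{\|H^k\|_\infty,\|V^k\|_\infty\}\le\tau\max\{\|H^{k-1}\|_\infty,\|V^{k-1}\|_\infty\}$, set $\rho_{k+1}=\rho_k$; otherwise set $\rho_{k+1}=\gamma\rho_k$. - Set $u_i^k(t)=\tilde{u}_i^k(t)+\rho_kh_i(x^k(t),t)$ and $v_j^k(t)=\max\{\tilde{v}_j^k(t)+\rho_kg_j(x^k(t),t),0\}$; then $\tilde{u}_i^{k+1}(t)=\mathrm{proj}_{[-M,M]}(u_i^k(t))$ and $\tilde{v}_j^{k+1}(t)=\mathrm{proj}_{[0,N]}(v_j^k(t))$. A sequence generated by the method means an infinite sequence $\{x^k\}_{k\in\mathbb{N}}$ produced in this way (no stopping test terminates it). (H3) There exists a sequence $\{\varepsilon^k\}_{k\in\mathbb{N}}\subset L^1([0,T];\mathbb{R}^n)$ with $\varepsilon^k\rightharpoonup 0$ weakly in $L^1([0,T];\mathbb{R}^n)$ such that $\nabla_xL_{\rho_k}(x^k(t),\tilde{u}^k(t),\tilde{v}^k(t),t)=\varepsilon^k(t)$ for a.e. $t\in[0,T]$ and all $k\in\mathbb{N}$. *)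

theory Defs
  imports "HOL-Probability.Probability"
begin

section \<open>Lebesgue spaces on a compact interval\<close>

text \<open>
  Elements of \<open>L\<^sup>\<infinity>\<close> and \<open>L\<^sup>1\<close> are represented by functions on the real line whose values
  outside \<open>[0,T]\<close> are irrelevant; identities between them are required almost everywhere.
\<close>

abbreviation leb :: "real \<Rightarrow> real measure" where
  "leb T \<equiv> lebesgue_on {0..T}"

definition Linf :: "real \<Rightarrow> (real \<Rightarrow> 'a::euclidean_space) \<Rightarrow> bool" where
  "Linf T f \<longleftrightarrow>
     f \<in> borel_measurable (leb T) \<and> (\<exists>C. AE t in leb T. norm (f t) \<le> C)"

text \<open>The essential supremum of the Euclidean norm; it is \<open>\<infinity>\<close> if \<open>f\<close> is not essentially bounded.\<close>

definition Linf_norm :: "real \<Rightarrow> (real \<Rightarrow> 'a::euclidean_space) \<Rightarrow> ereal" where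
  "Linf_norm T f = esssup (leb T) (\<lambda>t. ereal (norm (f t)))"

text \<open>
  The bounded linear functionals on \<open>L\<^sup>1\<close>, given on representatives. The bound (applied to a
  difference) makes \<open>\<Lambda>\<close> independent of the choice of representative.
\<close>

definition L1_dual :: "real \<Rightarrow> ((real \<Rightarrow> 'a::euclidean_space) \<Rightarrow> real) \<Rightarrow> bool" where
  "L1_dual T \<Lambda> \<longleftrightarrow>
     (\<forall>f g. integrable (leb T) f \<longrightarrow> integrable (leb T) g \<longrightarrow>
        \<Lambda> (\<lambda>t. f t + g t) = \<Lambda> f + \<Lambda> g) \<and>
     (\<forall>a f. integrable (leb T) f \<longrightarrow> \<Lambda> (\<lambda>t. a *\<^sub>R f t) = a * \<Lambda> f) \<and>
     (\<exists>C. \<forall>f. integrable (leb T) f \<longrightarrow> \<bar>\<Lambda> f\<bar> \<le> C * (\<integral>t. norm (f t) \<partial>leb T))"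

text \<open>Sequences in this theory that carry the iteration counter are used from index 1 on.\<close>

definition weakly_null_L1 :: "real \<Rightarrow> (nat \<Rightarrow> real \<Rightarrow> 'a::euclidean_space) \<Rightarrow> bool" where
  "weakly_null_L1 T \<epsilon> \<longleftrightarrow>
     (\<forall>k\<ge>1. integrable (leb T) (\<epsilon> k)) \<and>
     (\<forall>\<Lambda>. L1_dual T \<Lambda> \<longrightarrow> (\<lambda>k. \<Lambda> (\<epsilon> k)) \<longlonglongrightarrow> 0)"

section \<open>Differentiability\<close>

definition cont_diff :: "('a::euclidean_space \<Rightarrow> 'b::euclidean_space) \<Rightarrow> bool" where
  "cont_diff f \<longleftrightarrow>
     (\<exists>f' :: 'a \<Rightarrow> 'a \<Rightarrow>\<^sub>L 'b.
        (\<forall>x. (f has_derivative blinfun_apply (f' x)) (at x)) \<and> continuous_on UNIV f')"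

definition grad :: "('a::euclidean_space \<Rightarrow> real) \<Rightarrow> 'a \<Rightarrow> 'a" where
  "grad f x = (THE D. GDERIV f x :> D)"

text \<open>
  Stationarity for the problem of minimizing the integral of \<open>\<psi>(x(t),t)\<close> over \<open>L\<^sup>\<infinity>\<close>. The relation
  \<open>GDERIV\<close> includes differentiability at the point.
\<close>

definition stationary_point ::
    "real \<Rightarrow> ('a::euclidean_space \<Rightarrow> real \<Rightarrow> real) \<Rightarrow> (real \<Rightarrow> 'a) \<Rightarrow> bool" where
  "stationary_point T \<psi> xbar \<longleftrightarrow>
     Linf T xbar \<and> (AE t in leb T. GDERIV (\<lambda>y. \<psi> y t) (xbar t) :> 0)"

section \<open>The hypotheses on the data\<close>

definition H1 ::
    "real \<Rightarrow> real \<Rightarrow> (real \<Rightarrow> real ^ 'n) \<Rightarrow> (real ^ 'n \<Rightarrow> real \<Rightarrow> real) \<Rightarrow> bool" where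
  "H1 T r xbar \<phi> \<longleftrightarrow>
     (AE t in leb T. cont_diff (\<lambda>y. \<phi> y t)) \<and>
     (\<forall>y. (\<lambda>t. \<phi> y t) \<in> borel_measurable (leb T)) \<and>
     integrable (leb T) (\<lambda>t. \<bar>\<phi> (xbar t) t\<bar>) \<and>
     (\<exists>c. integrable (leb T) c \<and>
        (AE t in leb T. \<forall>y\<in>cball (xbar t) r. \<forall>z\<in>cball (xbar t) r.
            \<bar>\<phi> y t - \<phi> z t\<bar> \<le> c t * norm (y - z)))"

definition H2 ::
    "real \<Rightarrow> real \<Rightarrow> (real \<Rightarrow> real ^ 'n) \<Rightarrow> (real ^ 'n \<Rightarrow> real \<Rightarrow> real ^ 'p) \<Rightarrow>
     (real ^ 'n \<Rightarrow> real \<Rightarrow> real ^ 'm) \<Rightarrow> bool" where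
  "H2 T r xbar h g \<longleftrightarrow>
     (AE t in leb T. cont_diff (\<lambda>y. (h y t, g y t))) \<and>
     (\<forall>y. (\<lambda>t. (h y t, g y t)) \<in> borel_measurable (leb T)) \<and>
     integrable (leb T) (\<lambda>t. norm (h (xbar t) t, g (xbar t) t)) \<and>
     (\<exists>c. integrable (leb T) c \<and>
        (AE t in leb T. \<forall>y\<in>cball (xbar t) r. \<forall>z\<in>cball (xbar t) r.
            norm ((h y t, g y t) - (h z t, g z t)) \<le> c t * norm (y - z)))"

text \<open>The matrices \<open>\<nabla>\<^sub>x h\<close> and \<open>\<nabla>\<^sub>x g\<close> are measured in the operator norm.\<close>

definition H4 ::
    "real \<Rightarrow> (real \<Rightarrow> real ^ 'n) \<Rightarrow> (real ^ 'n \<Rightarrow> real \<Rightarrow> real) \<Rightarrow>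
     (real ^ 'n \<Rightarrow> real \<Rightarrow> real ^ 'p) \<Rightarrow> (real ^ 'n \<Rightarrow> real \<Rightarrow> real ^ 'm) \<Rightarrow> bool" where
  "H4 T xbar \<phi> h g \<longleftrightarrow>
     (\<exists>\<delta>>0. \<exists>c. integrable (leb T) c \<and>
        (AE t in leb T. \<forall>y\<in>cball (xbar t) \<delta>.
            norm (grad (\<lambda>z. \<phi> z t) y)
            + onorm (frechet_derivative (\<lambda>z. h z t) (at y))
            + onorm (frechet_derivative (\<lambda>z. g z t) (at y)) \<le> c t))"

section \<open>The augmented Lagrangian method\<close>

definition aug_lagrangian ::
    "(real ^ 'n \<Rightarrow> real \<Rightarrow> real) \<Rightarrow> (real ^ 'n \<Rightarrow> real \<Rightarrow> real ^ 'p) \<Rightarrow>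
     (real ^ 'n \<Rightarrow> real \<Rightarrow> real ^ 'm) \<Rightarrow> real \<Rightarrow>
     real ^ 'n \<Rightarrow> real ^ 'p \<Rightarrow> real ^ 'm \<Rightarrow> real \<Rightarrow> real" where
  "aug_lagrangian \<phi> h g \<rho> x u v t =
     \<phi> x t + \<rho> / 2 * (\<Sum>i\<in>UNIV. (h x t $ i + u $ i / \<rho>)\<^sup>2)
           + \<rho> / 2 * (\<Sum>j\<in>UNIV. (max 0 (g x t $ j + v $ j / \<rho>))\<^sup>2)"

definition alm_H ::
    "(real ^ 'n \<Rightarrow> real \<Rightarrow> real ^ 'p) \<Rightarrow> (nat \<Rightarrow> real \<Rightarrow> real ^ 'n) \<Rightarrow>
     nat \<Rightarrow> real \<Rightarrow> real ^ 'p" where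
  "alm_H h x k t = h (x k t) t"

definition alm_V ::
    "(real ^ 'n \<Rightarrow> real \<Rightarrow> real ^ 'm) \<Rightarrow> (nat \<Rightarrow> real \<Rightarrow> real ^ 'n) \<Rightarrow>
     (nat \<Rightarrow> real \<Rightarrow> real ^ 'm) \<Rightarrow> (nat \<Rightarrow> real) \<Rightarrow> nat \<Rightarrow> real \<Rightarrow> real ^ 'm" where
  "alm_V g x vt \<rho> k t =
     (\<chi> j. if k = 0 then max (g (x 0 t) t $ j) 0
           else max (g (x k t) t $ j) (- (vt k t $ j) / \<rho> k))"

definition alm_res ::
    "real \<Rightarrow> (real ^ 'n \<Rightarrow> real \<Rightarrow> real ^ 'p) \<Rightarrow> (real ^ 'n \<Rightarrow> real \<Rightarrow> real ^ 'm) \<Rightarrow>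
     (nat \<Rightarrow> real \<Rightarrow> real ^ 'n) \<Rightarrow> (nat \<Rightarrow> real \<Rightarrow> real ^ 'm) \<Rightarrow> (nat \<Rightarrow> real) \<Rightarrow>
     nat \<Rightarrow> ereal" where
  "alm_res T h g x vt \<rho> k =
     max (Linf_norm T (alm_H h x k)) (Linf_norm T (alm_V g x vt \<rho> k))"

text \<open>
  \<open>(x, ut, vt, \<rho>)\<close> is an infinite run of the method, where \<open>ut\<close>, \<open>vt\<close> are the safeguarded
  multipliers; the unprojected multipliers are the arguments of \<open>closest_point\<close>. Only \<open>x\<close> has a
  meaningful entry at index 0. The sense in which \<open>x k\<close> approximately solves the \<open>k\<close>-th
  subproblem, the only place where the cost \<open>\<phi>\<close> enters, is the separate hypothesis \<open>H3\<close>.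
\<close>

definition alm_generated ::
    "real \<Rightarrow> (real ^ 'n \<Rightarrow> real \<Rightarrow> real ^ 'p) \<Rightarrow> (real ^ 'n \<Rightarrow> real \<Rightarrow> real ^ 'm) \<Rightarrow>
     real \<Rightarrow> real \<Rightarrow> real \<Rightarrow> real \<Rightarrow> real \<Rightarrow>
     (nat \<Rightarrow> real \<Rightarrow> real ^ 'n) \<Rightarrow> (nat \<Rightarrow> real \<Rightarrow> real ^ 'p) \<Rightarrow>
     (nat \<Rightarrow> real \<Rightarrow> real ^ 'm) \<Rightarrow> (nat \<Rightarrow> real) \<Rightarrow> bool" where
  "alm_generated T h g M N \<gamma> \<rho>\<^sub>1 \<tau> x ut vt \<rho> \<longleftrightarrow>
     (\<forall>k. Linf T (x k)) \<and>
     Linf T (ut 1) \<and> (AE t in leb T. \<forall>i. ut 1 t $ i \<in> {-M..M}) \<and>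
     Linf T (vt 1) \<and> (AE t in leb T. \<forall>j. vt 1 t $ j \<in> {0..N}) \<and>
     \<rho> 1 = \<rho>\<^sub>1 \<and>
     (\<forall>k\<ge>1.
        Linf T (alm_H h x k) \<and> Linf T (alm_V g x vt \<rho> k) \<and>
        \<rho> (Suc k) =
          (if alm_res T h g x vt \<rho> k \<le> ereal \<tau> * alm_res T h g x vt \<rho> (k - 1)
           then \<rho> k else \<gamma> * \<rho> k) \<and>
        (AE t in leb T. \<forall>i.
           ut (Suc k) t $ i = closest_point {-M..M} (ut k t $ i + \<rho> k * h (x k t) t $ i)) \<and>
        (AE t in leb T. \<forall>j.
           vt (Suc k) t $ j =
             closest_point {0..N} (max (vt k t $ j + \<rho> k * g (x k t) t $ j) 0)))"

definition H3 ::
    "real \<Rightarrow> (real ^ 'n \<Rightarrow> real \<Rightarrow> real) \<Rightarrow> (real ^ 'n \<Rightarrow> real \<Rightarrow> real ^ 'p) \<Rightarrow>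
     (real ^ 'n \<Rightarrow> real \<Rightarrow> real ^ 'm) \<Rightarrow>
     (nat \<Rightarrow> real \<Rightarrow> real ^ 'n) \<Rightarrow> (nat \<Rightarrow> real \<Rightarrow> real ^ 'p) \<Rightarrow>
     (nat \<Rightarrow> real \<Rightarrow> real ^ 'm) \<Rightarrow> (nat \<Rightarrow> real) \<Rightarrow> bool" where
  "H3 T \<phi> h g x ut vt \<rho> \<longleftrightarrow>
     (\<exists>\<epsilon>. weakly_null_L1 T \<epsilon> \<and>
        (\<forall>k\<ge>1. AE t in leb T.
           GDERIV (\<lambda>y. aug_lagrangian \<phi> h g (\<rho> k) y (ut k t) (vt k t) t) (x k t) :> \<epsilon> k t))"

end

theory Submission
  imports Defs
begin

text \<open>
  If the penalty parameter stays bounded, the residuals decrease geometrically, so \<open>xbar\<close> is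
  feasible and the gradient vanishes trivially. Otherwise \<open>\<rho> k\<close> tends to infinity, and
  \<open>\<epsilon> k / \<rho> k\<close> converges almost everywhere to half the gradient of the infeasibility measure.
  It is also weakly null in \<open>L\<^sup>1\<close>, and a weak limit in \<open>L\<^sup>1\<close> agrees with a pointwise
  limit, as one sees by testing with its sign on sets where the sequence is dominated.
\<close>

section \<open>Weak convergence in L1\<close>

text \<open>Supplies the test functionals for weak convergence. Cauchy-Schwarz gives both the
  integrability of the pairing and the bound required by \<open>L1_dual\<close>.\<close>

lemma L1_dual_inner_bounded:
  fixes \<psi> :: "real \<Rightarrow> 'a::euclidean_space"
  assumes [measurable]: "\<psi> \<in> borel_measurable (leb T)"
    and bound: "\<And>t. norm (\<psi> t) \<le> B"
  shows "L1_dual T (\<lambda>f. \<integral>t. \<psi> t \<bullet> f t \<partial>leb T)"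
proof -
  have int: "integrable (leb T) (\<lambda>t. \<psi> t \<bullet> f t)"
    if f: "integrable (leb T) f" for f :: "real \<Rightarrow> 'a"
  proof (rule Bochner_Integration.integrable_bound)
    show "integrable (leb T) (\<lambda>t. B *\<^sub>R f t)"
      using f by simp
    have [measurable]: "f \<in> borel_measurable (leb T)"
      using f by (rule borel_measurable_integrable)
    show "(\<lambda>t. \<psi> t \<bullet> f t) \<in> borel_measurable (leb T)"
      by measurable
    have "norm (\<psi> t \<bullet> f t) \<le> norm (B *\<^sub>R f t)" for t
    proof -
      have "norm (\<psi> t \<bullet> f t) \<le> norm (\<psi> t) * norm (f t)"
        by (simp add: Cauchy_Schwarz_ineq2)
      also have "\<dots> \<le> \<bar>B\<bar> * norm (f t)"
        using bound[of t] by (intro mult_right_mono) auto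
      finally show ?thesis by simp
    qed
    then show "AE t in leb T. norm (\<psi> t \<bullet> f t) \<le> norm (B *\<^sub>R f t)"
      by simp
  qed
  have "\<bar>\<integral>t. \<psi> t \<bullet> f t \<partial>leb T\<bar> \<le> B * (\<integral>t. norm (f t) \<partial>leb T)"
    if f: "integrable (leb T) f" for f :: "real \<Rightarrow> 'a"
  proof -
    have "\<bar>\<integral>t. \<psi> t \<bullet> f t \<partial>leb T\<bar> \<le> (\<integral>t. \<bar>\<psi> t \<bullet> f t\<bar> \<partial>leb T)"
      by (rule integral_abs_bound)
    also have "\<dots> \<le> (\<integral>t. B * norm (f t) \<partial>leb T)"
    proof (rule integral_mono)
      show "\<bar>\<psi> t \<bullet> f t\<bar> \<le> B * norm (f t)" for t
        using Cauchy_Schwarz_ineq2[of "\<psi> t" "f t"] mult_right_mono[OF bound, of "norm (f t)" t]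
        by simp
    qed (use int[OF f] f in auto)
    finally show ?thesis by simp
  qed
  then show ?thesis
    unfolding L1_dual_def using int by (auto simp: inner_add_right)
qed

text \<open>The a.e. limit \<open>f\<close> is tested against its own direction, cut off to a set
  where a tail of the sequence is bounded by a constant. The interval has finite measure, so
  dominated convergence applies and the limit of the pairings is the integral of
  \<open>norm (f t)\<close> over that set; weak nullity makes it 0.\<close>

lemma weakly_null_L1_AE_convergent:
  fixes e :: "nat \<Rightarrow> real \<Rightarrow> 'a::euclidean_space"
  assumes weak: "weakly_null_L1 T e"
    and conv: "AE t in leb T. convergent (\<lambda>k. e k t)"
  shows "AE t in leb T. (\<lambda>k. e k t) \<longlonglongrightarrow> 0"
proof -
  \<comment> \<open>\<open>weakly_null_L1\<close> says nothing about \<open>e 0\<close>, not even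
    measurability, so the sequence is shifted to start at index 1.\<close>
  define s where "s k t = e (Suc k) t" for k t
  define f where "f t = lim (\<lambda>k. s k t)" for t
  have ints: "integrable (leb T) (s k)" for k
    using weak by (simp add: weakly_null_L1_def s_def[abs_def])
  have [measurable]: "s k \<in> borel_measurable (leb T)" for k
    using ints by (rule borel_measurable_integrable)
  have [measurable]: "f \<in> borel_measurable (leb T)"
    unfolding f_def by measurable
  have lim: "AE t in leb T. (\<lambda>k. s k t) \<longlonglongrightarrow> f t"
    using conv
  proof eventually_elim
    case (elim t)
    then have "convergent (\<lambda>k. s k t)"
      unfolding s_def by (subst convergent_Suc_iff)
    then show ?case
      by (simp add: f_def convergent_LIMSEQ_iff)
  qed
  \<comment> \<open>Dominated convergence applies on each set \<open>A m\<close>, and these sets exhaust the points of convergence.\<close>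
  define A where "A m t \<longleftrightarrow> (\<forall>k\<ge>m. norm (s k t) \<le> real m)" for m t
  have [measurable]: "Measurable.pred (leb T) (A m)" for m
    unfolding A_def by measurable
  \<comment> \<open>For vectors, \<open>sgn\<close> is the normalised direction (0 at 0), so pairing
    with \<open>f\<close> gives \<open>norm (f t)\<close> on \<open>A m\<close> and 0
    elsewhere.\<close>
  define \<psi> where "\<psi> m t = (if A m t then sgn (f t) else 0)" for m t
  have psi_meas [measurable]: "\<psi> m \<in> borel_measurable (leb T)" for m
    unfolding \<psi>_def sgn_div_norm by measurable
  have psi_bound: "norm (\<psi> m t) \<le> 1" for m t
    by (simp add: \<psi>_def norm_sgn)
  have "AE t in leb T. A m t \<longrightarrow> f t = 0" for m
  proof -
    \<comment> \<open>\<open>A m\<close> controls \<open>s\<close> only from index m on; the offset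
      by m makes the bound hold for every k.\<close>
    have bound: "norm (\<psi> m t \<bullet> s (k + m) t) \<le> real m" for k t
    proof (cases "A m t")
      case True
      have "norm (\<psi> m t \<bullet> s (k + m) t) \<le> norm (\<psi> m t) * norm (s (k + m) t)"
        by (simp add: Cauchy_Schwarz_ineq2)
      also have "\<dots> \<le> 1 * real m"
        using True by (intro mult_mono psi_bound) (auto simp: A_def)
      finally show ?thesis by simp
    qed (simp add: \<psi>_def)
    have ptw: "AE t in leb T. (\<lambda>k. \<psi> m t \<bullet> s (k + m) t) \<longlonglongrightarrow> \<psi> m t \<bullet> f t"
      using lim by eventually_elim (intro tendsto_intros LIMSEQ_ignore_initial_segment)
    have const: "integrable (leb T) (\<lambda>t. real m)"
      by (intro finite_measure.integrable_const finite_measureI)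
        (use emeasure_bounded_finite[OF bounded_closed_interval, of 0 T] in
          \<open>auto simp: emeasure_restrict_space space_restrict_space\<close>)
    have "(\<lambda>k. \<integral>t. \<psi> m t \<bullet> s (k + m) t \<partial>leb T) \<longlonglongrightarrow> (\<integral>t. \<psi> m t \<bullet> f t \<partial>leb T)"
      by (rule integral_dominated_convergence[OF _ _ const ptw]) (use bound in auto)
    moreover have "(\<lambda>k. \<integral>t. \<psi> m t \<bullet> s (k + m) t \<partial>leb T) \<longlonglongrightarrow> 0"
    proof -
      have "(\<lambda>k. \<integral>t. \<psi> m t \<bullet> e k t \<partial>leb T) \<longlonglongrightarrow> 0"
        using weak L1_dual_inner_bounded[OF psi_meas psi_bound]
        by (auto simp: weakly_null_L1_def)
      then show ?thesis
        unfolding s_def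
        \<comment> \<open>\<open>s (k + m)\<close> is \<open>e (k + Suc m)\<close>: the shift in
          \<open>s\<close> and the offset m add up.\<close>
        using LIMSEQ_ignore_initial_segment[where k = "Suc m"] by fastforce
    qed
    ultimately have zero: "(\<integral>t. \<psi> m t \<bullet> f t \<partial>leb T) = 0"
      using LIMSEQ_unique by blast
    have nn: "\<psi> m t \<bullet> f t = (if A m t then norm (f t) else 0)" for t
      by (cases "f t = 0") (simp_all add: \<psi>_def sgn_div_norm dot_square_norm power2_eq_square)
    \<comment> \<open>The Bochner integral of a non-integrable function is 0 by default, so
      integrability has to precede the conclusion that a nonnegative function with zero integral
      vanishes a.e.\<close>
    have "integrable (leb T) (\<lambda>t. \<psi> m t \<bullet> f t)"
      by (rule integrable_dominated_convergence[OF _ _ const ptw]) (use bound in auto)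
    then have "AE t in leb T. \<psi> m t \<bullet> f t = 0"
      using zero by (subst integral_nonneg_eq_0_iff_AE[symmetric]) (auto simp: nn)
    then show ?thesis
      by eventually_elim (auto simp: nn split: if_splits)
  qed
  then have "AE t in leb T. \<forall>m. A m t \<longrightarrow> f t = 0"
    by (subst AE_all_countable) blast
  with lim show ?thesis
  proof eventually_elim
    case (elim t)
    obtain B where B: "\<And>k. norm (s k t) \<le> B"
      using elim(1) by (metis BseqE convergentI convergent_imp_Bseq)
    obtain m :: nat where "B \<le> real m"
      using real_arch_simple by blast
    then have "A m t"
      unfolding A_def using B order_trans by blast
    with elim have "(\<lambda>k. e (Suc k) t) \<longlonglongrightarrow> 0"
      by (simp add: s_def)
    then show ?case
      by (rule LIMSEQ_imp_Suc)
  qed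
qed

text \<open>Used with the reciprocal penalties as \<open>c\<close>, to pass from the stationarity
  errors to the rescaled ones.\<close>

lemma weakly_null_L1_scaleR:
  assumes weak: "weakly_null_L1 T e" and c: "c \<longlonglongrightarrow> 0"
  shows "weakly_null_L1 T (\<lambda>k t. c k *\<^sub>R e k t)"
  unfolding weakly_null_L1_def
proof (intro conjI allI impI)
  show "integrable (leb T) (\<lambda>t. c k *\<^sub>R e k t)" if "1 \<le> k" for k
    using weak that by (simp add: weakly_null_L1_def)
  fix \<Lambda> :: "(real \<Rightarrow> 'a) \<Rightarrow> real"
  assume \<Lambda>: "L1_dual T \<Lambda>"
  have "(\<lambda>k. c k * \<Lambda> (e k)) \<longlonglongrightarrow> 0"
    using weak \<Lambda> c by (intro tendsto_mult_zero) (auto simp: weakly_null_L1_def)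
  \<comment> \<open>Homogeneity of \<Lambda> is granted on integrable functions only, which leaves
    index 0 open.\<close>
  moreover have "eventually (\<lambda>k. c k * \<Lambda> (e k) = \<Lambda> (\<lambda>t. c k *\<^sub>R e k t)) sequentially"
    using eventually_ge_at_top[of "1::nat"]
  proof eventually_elim
    case (elim k)
    with weak \<Lambda> show ?case
      unfolding weakly_null_L1_def L1_dual_def by presburger
  qed
  ultimately show "(\<lambda>k. \<Lambda> (\<lambda>t. c k *\<^sub>R e k t)) \<longlonglongrightarrow> 0"
    using tendsto_cong by fast
qed

section \<open>Derivatives of squared residuals and gradients\<close>

text \<open>Squaring smooths the kink of the positive part: away from 0 the function is locally 0 or
  a square, and at 0 the difference quotient is bounded by \<open>\<bar>y\<bar>\<close>. Hence the
  inequality terms of the augmented Lagrangian are differentiable.\<close>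

lemma has_real_derivative_max_0_square:
  fixes s :: real
  shows "((\<lambda>s. (max 0 s)\<^sup>2) has_real_derivative 2 * max 0 s) (at s)"
proof (cases s "0::real" rule: linorder_cases)
  case less
  have "((\<lambda>s. 0) has_real_derivative 0) (at s)"
    by simp
  moreover have "eventually (\<lambda>y. y < 0) (nhds s)"
    using less by (simp add: eventually_nhds_in_open[of "{..<0}", simplified])
  then have "eventually (\<lambda>y. 0 = (max 0 y)\<^sup>2) (nhds s)"
    by eventually_elim simp
  ultimately show ?thesis
    using less by (subst (asm) DERIV_cong_ev[OF refl]) auto
next
  case equal
  have "(\<lambda>y::real. \<bar>y\<bar>) \<midarrow>0\<rightarrow> 0"
    by (rule tendsto_eq_intros | simp)+
  moreover have "eventually (\<lambda>y::real. norm ((max 0 y)\<^sup>2 / y) \<le> \<bar>y\<bar>) (at 0)"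
    by (rule always_eventually) (auto simp: max_def power2_eq_square)
  ultimately have "(\<lambda>y::real. (max 0 y)\<^sup>2 / y) \<midarrow>0\<rightarrow> 0"
    by (rule Lim_null_comparison[rotated])
  then show ?thesis
    using equal by (simp add: DERIV_def)
next
  case greater
  have "((\<lambda>s. s\<^sup>2) has_real_derivative 2 * s) (at s)"
    by (auto intro!: derivative_eq_intros)
  moreover have "eventually (\<lambda>y. y > 0) (nhds s)"
    using greater by (simp add: eventually_nhds_in_open[of "{0<..}", simplified])
  then have "eventually (\<lambda>y. y\<^sup>2 = (max 0 y)\<^sup>2) (nhds s)"
    by eventually_elim simp
  ultimately show ?thesis
    using greater by (subst (asm) DERIV_cong_ev[OF refl]) auto
qed

text \<open>The shift \<open>c\<close> lets one formula serve both the augmented Lagrangian, where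
  it is the multiplier divided by the penalty, and the infeasibility measure, where it is 0.\<close>

lemma has_derivative_sum_square:
  fixes f :: "'a::real_normed_vector \<Rightarrow> real ^ 'p"
  assumes f: "(f has_derivative f') (at x)"
  shows "((\<lambda>y. \<Sum>i\<in>UNIV. (f y $ i + c i)\<^sup>2) has_derivative
    (\<lambda>w. 2 * (\<Sum>i\<in>UNIV. (f x $ i + c i) * f' w $ i))) (at x)"
  unfolding sum_distrib_left
proof (rule has_derivative_sum)
  fix i
  have "((\<lambda>y. f y $ i + c i) has_derivative (\<lambda>w. f' w $ i)) (at x)"
    by (auto intro!: derivative_eq_intros bounded_linear.has_derivative[OF bounded_linear_vec_nth] f)
  from has_derivative_power[OF this, of 2]
  show "((\<lambda>y. (f y $ i + c i)\<^sup>2) has_derivative (\<lambda>w. 2 * ((f x $ i + c i) * f' w $ i))) (at x)"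
    by (simp add: mult_ac)
qed

lemma has_derivative_sum_max_0_square:
  fixes f :: "'a::real_normed_vector \<Rightarrow> real ^ 'p"
  assumes f: "(f has_derivative f') (at x)"
  shows "((\<lambda>y. \<Sum>i\<in>UNIV. (max 0 (f y $ i + c i))\<^sup>2) has_derivative
    (\<lambda>w. 2 * (\<Sum>i\<in>UNIV. max 0 (f x $ i + c i) * f' w $ i))) (at x)"
  unfolding sum_distrib_left
proof (rule has_derivative_sum)
  fix i
  have "((\<lambda>y. f y $ i + c i) has_derivative (\<lambda>w. f' w $ i)) (at x)"
    by (auto intro!: derivative_eq_intros bounded_linear.has_derivative[OF bounded_linear_vec_nth] f)
  then show "((\<lambda>y. (max 0 (f y $ i + c i))\<^sup>2) has_derivative
      (\<lambda>w. 2 * (max 0 (f x $ i + c i) * f' w $ i))) (at x)"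
    using has_derivative_compose[OF _ has_real_derivative_max_0_square[unfolded has_field_derivative_def]]
    by (fastforce simp: mult.assoc)
qed

text \<open>Riesz representation in coordinates, from expanding the direction in the basis. The
  explicit vector allows componentwise limits later.\<close>

lemma has_derivative_imp_GDERIV:
  fixes f :: "'a::euclidean_space \<Rightarrow> real"
  assumes f: "(f has_derivative f') (at x)"
  shows "GDERIV f x :> (\<Sum>b\<in>Basis. f' b *\<^sub>R b)"
proof -
  have lin: "linear f'"
    using f by (simp add: has_derivative_linear)
  have "f' w = w \<bullet> (\<Sum>b\<in>Basis. f' b *\<^sub>R b)" for w
  proof -
    have "f' w = f' (\<Sum>b\<in>Basis. (w \<bullet> b) *\<^sub>R b)"
      by (simp add: euclidean_representation)
    also have "\<dots> = (\<Sum>b\<in>Basis. (w \<bullet> b) * f' b)"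
      by (simp add: linear_sum[OF lin] linear_scale[OF lin])
    finally show ?thesis
      by (simp add: inner_sum_right mult.commute)
  qed
  then have "f' = (\<lambda>w. w \<bullet> (\<Sum>b\<in>Basis. f' b *\<^sub>R b))"
    by blast
  with f show ?thesis
    unfolding gderiv_def by metis
qed

text \<open>By uniqueness of derivatives; it reads the components of the stationarity errors off an
  explicit derivative.\<close>

lemma GDERIV_inner_eq:
  assumes "GDERIV f x :> D" and "(f has_derivative f') (at x)"
  shows "D \<bullet> w = f' w"
  using has_derivative_unique[OF assms(1)[unfolded gderiv_def] assms(2)]
  by (metis inner_commute)

text \<open>Continuity of the derivative in operator norm is weakened to continuity along each fixed
  direction, the form in which limits are taken on basis vectors.\<close>

lemma cont_diffE:
  assumes "cont_diff f"
  obtains f' where "\<And>x. (f has_derivative blinfun_apply (f' x)) (at x)"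
    and "\<And>w a. isCont (\<lambda>x. blinfun_apply (f' x) w) a"
proof -
  obtain f' where d: "\<And>x. (f has_derivative blinfun_apply (f' x)) (at x)"
    and c: "continuous_on UNIV f'"
    using assms unfolding cont_diff_def by blast
  have "isCont (\<lambda>x. blinfun_apply (f' x) w) a" for w a
    using c by (intro continuous_intros) (simp add: continuous_on_eq_continuous_at)
  then show ?thesis
    using that d by blast
qed

section \<open>Penalty growth, multiplier bounds and residual decay\<close>

text \<open>From index m on the sequence is positive and nondecreasing, and after n jumps it has
  reached at least \<open>\<gamma> ^ n * r m\<close>.\<close>

lemma filterlim_geometric_jumps_at_top:
  fixes r :: "nat \<Rightarrow> real"
  assumes "0 < r m" and \<gamma>: "1 < \<gamma>"
    and step: "\<And>k. m \<le> k \<Longrightarrow> r (Suc k) = r k \<or> r (Suc k) = \<gamma> * r k"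
    and jumps: "\<exists>\<^sub>\<infinity>k. r (Suc k) = \<gamma> * r k"
  shows "filterlim r at_top sequentially"
proof -
  have pos: "0 < r k" if "m \<le> k" for k
    using that
  proof (induction k rule: dec_induct)
    case (step n)
    with assms(3)[of n] \<gamma> show ?case by auto
  qed (rule assms(1))
  have Suc_mono: "r k \<le> r (Suc k)" if "m \<le> k" for k
    using step[OF that] pos[OF that] \<gamma> by auto
  have mono: "r k \<le> r l" if "m \<le> k" "k \<le> l" for k l
    using that(2)
  proof (induction l rule: dec_induct)
    case (step n)
    then show ?case
      using Suc_mono[of n] that(1) by linarith
  qed simp
  have pow: "\<exists>k\<ge>m. \<gamma> ^ n * r m \<le> r k" for n
  proof (induction n)
    case (Suc n)
    then obtain k where k: "m \<le> k" "\<gamma> ^ n * r m \<le> r k" by blast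
    obtain l where l: "k \<le> l" "r (Suc l) = \<gamma> * r l"
      using jumps by (meson INFM_nat_le)
    have "\<gamma> * (\<gamma> ^ n * r m) \<le> \<gamma> * r l"
      using k mono[OF k(1) l(1)] \<gamma> by (intro mult_left_mono) auto
    then show ?case
      using k l by (intro exI[of _ "Suc l"]) auto
  qed auto
  show ?thesis
    unfolding filterlim_at_top eventually_sequentially
  proof
    fix Z
    obtain n where "Z / r m < \<gamma> ^ n"
      using real_arch_pow[OF \<gamma>] by blast
    then have "Z \<le> \<gamma> ^ n * r m"
      using assms(1) by (simp add: field_simps)
    with pow[of n] mono show "\<exists>N. \<forall>n\<ge>N. Z \<le> r n"
      by (meson order_trans)
  qed
qed

lemma AE_norm_le_Linf_norm:
  assumes "Linf T f"
  shows "AE t in leb T. ereal (norm (f t)) \<le> Linf_norm T f"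
  unfolding Linf_norm_def by (rule esssup_AE)

text \<open>\<open>Linf_norm\<close> is extended real; the geometric estimate for the residuals
  needs a real starting value.\<close>

lemma Linf_norm_finite:
  assumes "Linf T f"
  obtains C where "Linf_norm T f \<le> ereal C"
proof -
  obtain C where "AE t in leb T. norm (f t) \<le> C"
    using assms unfolding Linf_def by blast
  moreover have [measurable]: "f \<in> borel_measurable (leb T)"
    using assms by (simp add: Linf_def)
  have "(\<lambda>t. ereal (norm (f t))) \<in> borel_measurable (leb T)"
    by measurable
  ultimately have "Linf_norm T f \<le> ereal C"
    unfolding Linf_norm_def by (intro esssup_I) auto
  then show ?thesis ..
qed

context
  fixes T M N \<gamma> \<rho>\<^sub>1 \<tau> :: real
    and h :: "real ^ 'n \<Rightarrow> real \<Rightarrow> real ^ 'p"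
    and g :: "real ^ 'n \<Rightarrow> real \<Rightarrow> real ^ 'm"
    and x :: "nat \<Rightarrow> real \<Rightarrow> real ^ 'n"
    and ut :: "nat \<Rightarrow> real \<Rightarrow> real ^ 'p"
    and vt :: "nat \<Rightarrow> real \<Rightarrow> real ^ 'm"
    and \<rho> :: "nat \<Rightarrow> real"
  assumes gen: "alm_generated T h g M N \<gamma> \<rho>\<^sub>1 \<tau> x ut vt \<rho>"
begin

text \<open>At index 1 the bound is part of the initial data; afterwards projection onto the
  interval, nonempty because \<open>M\<close> is positive, lands inside it. Countably many null sets
  combine into one.\<close>

lemma alm_multiplier_eq_bounded:
  assumes "M > 0"
  shows "AE t in leb T. \<forall>k\<ge>1. \<forall>i. \<bar>ut k t $ i\<bar> \<le> M"
proof -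
  have "AE t in leb T. \<forall>i. \<bar>ut (Suc k) t $ i\<bar> \<le> M" for k
  proof (cases k)
    case 0
    have "AE t in leb T. \<forall>i. ut 1 t $ i \<in> {-M..M}"
      using gen by (simp add: alm_generated_def)
    then show ?thesis
      by eventually_elim (auto simp: 0 abs_le_iff minus_le_iff)
  next
    case (Suc l)
    have "AE t in leb T. \<forall>i. ut (Suc k) t $ i
        = closest_point {-M..M} (ut k t $ i + \<rho> k * h (x k t) t $ i)"
      using gen Suc by (simp add: alm_generated_def)
    then show ?thesis
    proof eventually_elim
      case (elim t)
      have "ut (Suc k) t $ i \<in> {-M..M}" for i
        unfolding elim[rule_format] using assms by (intro closest_point_in_set) auto
      then show ?case
        by (auto simp: abs_le_iff minus_le_iff)
    qed
  qed
  then have "AE t in leb T. \<forall>k i. \<bar>ut (Suc k) t $ i\<bar> \<le> M"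
    by (simp add: AE_all_countable)
  then show ?thesis
    by eventually_elim (metis One_nat_def Suc_le_D)
qed

lemma alm_multiplier_ineq_bounded:
  assumes "N > 0"
  shows "AE t in leb T. \<forall>k\<ge>1. \<forall>j. \<bar>vt k t $ j\<bar> \<le> N"
proof -
  have "AE t in leb T. \<forall>j. \<bar>vt (Suc k) t $ j\<bar> \<le> N" for k
  proof (cases k)
    case 0
    have "AE t in leb T. \<forall>j. vt 1 t $ j \<in> {0..N}"
      using gen by (simp add: alm_generated_def)
    then show ?thesis
      by eventually_elim (auto simp: 0)
  next
    case (Suc l)
    have "AE t in leb T. \<forall>j. vt (Suc k) t $ j
        = closest_point {0..N} (max (vt k t $ j + \<rho> k * g (x k t) t $ j) 0)"
      using gen Suc by (simp add: alm_generated_def)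
    then show ?thesis
    proof eventually_elim
      case (elim t)
      have "vt (Suc k) t $ j \<in> {0..N}" for j
        unfolding elim[rule_format] using assms by (intro closest_point_in_set) auto
      then show ?case
        by auto
    qed
  qed
  then have "AE t in leb T. \<forall>k j. \<bar>vt (Suc k) t $ j\<bar> \<le> N"
    by (simp add: AE_all_countable)
  then show ?thesis
    by eventually_elim (metis One_nat_def Suc_le_D)
qed

text \<open>Once the decrease test always succeeds, the residual norms are dominated by a geometric
  sequence with ratio \<tau>, and the essential supremum bounds the pointwise norms a.e.\<close>

lemma alm_residual_tendsto_0:
  assumes \<tau>: "0 < \<tau>" "\<tau> < 1"
    and decrease: "\<forall>\<^sub>F k in sequentially.
      alm_res T h g x vt \<rho> k \<le> ereal \<tau> * alm_res T h g x vt \<rho> (k - 1)"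
  shows "AE t in leb T. (\<lambda>k. alm_H h x k t) \<longlonglongrightarrow> 0 \<and> (\<lambda>k. alm_V g x vt \<rho> k t) \<longlonglongrightarrow> 0"
proof -
  let ?r = "alm_res T h g x vt \<rho>"
  have Linf_H: "Linf T (alm_H h x k)" and Linf_V: "Linf T (alm_V g x vt \<rho> k)" if "1 \<le> k" for k
    using gen that by (auto simp: alm_generated_def)
  \<comment> \<open>Taking \<open>Suc K\<close> removes the truncated subtraction and ensures index
    at least 1, where the residuals are known to be essentially bounded; at index 0 the residual may
    be infinite.\<close>
  obtain K where K: "1 \<le> K" "\<And>k. K \<le> k \<Longrightarrow> ?r (Suc k) \<le> ereal \<tau> * ?r k"
  proof -
    obtain K where "\<And>k. K \<le> k \<Longrightarrow> ?r k \<le> ereal \<tau> * ?r (k - 1)"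
      using decrease by (auto simp: eventually_sequentially)
    from this[of "Suc _"] show ?thesis
      by (intro that[of "Suc K"]) auto
  qed
  obtain A B where "Linf_norm T (alm_H h x K) \<le> ereal A" "Linf_norm T (alm_V g x vt \<rho> K) \<le> ereal B"
    using Linf_norm_finite Linf_H Linf_V K(1) by metis
  then have C: "?r K \<le> ereal (max A B)"
    unfolding alm_res_def by (auto intro: order_trans simp: le_max_iff_disj)
  have r: "?r (n + K) \<le> ereal (\<tau> ^ n * max A B)" for n
  proof (induction n)
    case (Suc n)
    have "?r (Suc n + K) \<le> ereal \<tau> * ?r (n + K)"
      using K(2)[of "n + K"] by simp
    also have "\<dots> \<le> ereal \<tau> * ereal (\<tau> ^ n * max A B)"
      using Suc \<tau> by (intro ereal_mult_left_mono) auto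
    finally show ?case
      by (simp add: mult.assoc)
  qed (use C in simp)
  have "AE t in leb T. norm (alm_H h x (n + K) t) \<le> \<tau> ^ n * max A B
      \<and> norm (alm_V g x vt \<rho> (n + K) t) \<le> \<tau> ^ n * max A B" for n
  proof -
    have "1 \<le> n + K"
      using K(1) by simp
    from AE_norm_le_Linf_norm[OF Linf_H[OF this]] AE_norm_le_Linf_norm[OF Linf_V[OF this]]
    show ?thesis
    proof eventually_elim
      case (elim t)
      then have "ereal (norm (alm_H h x (n + K) t)) \<le> ?r (n + K)"
        "ereal (norm (alm_V g x vt \<rho> (n + K) t)) \<le> ?r (n + K)"
        unfolding alm_res_def by (simp_all add: le_max_iff_disj)
      with r[of n] show ?case
        using order_trans ereal_less_eq(3) by metis
    qed
  qed
  then have "AE t in leb T. \<forall>n. norm (alm_H h x (n + K) t) \<le> \<tau> ^ n * max A B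
      \<and> norm (alm_V g x vt \<rho> (n + K) t) \<le> \<tau> ^ n * max A B"
    by (simp add: AE_all_countable)
  then show ?thesis
  proof eventually_elim
    case (elim t)
    have "(\<lambda>n. \<tau> ^ n * max A B) \<longlonglongrightarrow> 0"
      using \<tau> by (intro tendsto_mult_left_zero LIMSEQ_power_zero) simp
    note null = LIMSEQ_offset[OF Lim_null_comparison[OF always_eventually this]]
    show ?case
      using elim by (intro conjI; intro null[of _ K]) auto
  qed
qed

text \<open>Every failed test multiplies the penalty by \<gamma>, so either the failures stop or
  they recur forever and drive the penalty to infinity.\<close>

lemma alm_penalty_cases:
  assumes "\<gamma> > 1" and "\<rho>\<^sub>1 > 0"
  obtains (bounded) "\<forall>\<^sub>F k in sequentially.
      alm_res T h g x vt \<rho> k \<le> ereal \<tau> * alm_res T h g x vt \<rho> (k - 1)"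
  | (unbounded) "filterlim \<rho> at_top sequentially"
proof -
  let ?P = "\<lambda>k. alm_res T h g x vt \<rho> k \<le> ereal \<tau> * alm_res T h g x vt \<rho> (k - 1)"
  have step: "\<rho> (Suc k) = (if ?P k then \<rho> k else \<gamma> * \<rho> k)" if "1 \<le> k" for k
    using gen that by (simp add: alm_generated_def)
  have "filterlim \<rho> at_top sequentially" if "\<not> (\<forall>\<^sub>F k in sequentially. ?P k)"
  proof (rule filterlim_geometric_jumps_at_top[of _ 1 \<gamma>])
    \<comment> \<open>The update rule holds from index 1 on, so the recurring failures are
      restricted to such indices.\<close>
    have "\<exists>\<^sub>F k in sequentially. \<not> ?P k \<and> 1 \<le> k"
      using that eventually_ge_at_top[of "1::nat"]
      by (intro frequently_eventually_frequently) (simp_all add: frequently_def)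
    then have "\<exists>\<^sub>F k in sequentially. \<rho> (Suc k) = \<gamma> * \<rho> k"
      by (rule frequently_elim1) (simp add: step)
    then show "\<exists>\<^sub>\<infinity>k. \<rho> (Suc k) = \<gamma> * \<rho> k"
      by (simp add: cofinite_eq_sequentially)
  qed (use assms gen step in \<open>auto simp: alm_generated_def\<close>)
  then show ?thesis
    using that by blast
qed

end

section \<open>Stationarity of the limit\<close>

text \<open>The 2 from the squares cancels against \<open>\<rho> / 2\<close>. With \<rho> factored
  out, division by \<rho> leaves the cost term and the multipliers with a factor
  \<open>1 / \<rho>\<close>.\<close>

lemma has_derivative_aug_lagrangian:
  assumes "((\<lambda>y. \<phi> y t) has_derivative \<phi>') (at x)" and h: "((\<lambda>y. h y t) has_derivative h') (at x)"
    and g: "((\<lambda>y. g y t) has_derivative g') (at x)"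
  shows "((\<lambda>y. aug_lagrangian \<phi> h g \<rho> y u v t) has_derivative
    (\<lambda>w. \<phi>' w + \<rho> * ((\<Sum>i\<in>UNIV. (h x t $ i + u $ i / \<rho>) * h' w $ i)
      + (\<Sum>j\<in>UNIV. max 0 (g x t $ j + v $ j / \<rho>) * g' w $ j)))) (at x)"
proof -
  have "((\<lambda>y. aug_lagrangian \<phi> h g \<rho> y u v t) has_derivative
    (\<lambda>w. \<phi>' w + \<rho> / 2 * (2 * (\<Sum>i\<in>UNIV. (h x t $ i + u $ i / \<rho>) * h' w $ i))
      + \<rho> / 2 * (2 * (\<Sum>j\<in>UNIV. max 0 (g x t $ j + v $ j / \<rho>) * g' w $ j)))) (at x)"
    unfolding aug_lagrangian_def
    by (intro has_derivative_add has_derivative_mult_right assms(1)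
        has_derivative_sum_square[OF h] has_derivative_sum_max_0_square[OF g])
  then show ?thesis
    by (simp add: distrib_left add.assoc)
qed

theorem theorem4p2:
  fixes T M N \<gamma> \<rho>\<^sub>1 \<tau> :: real
    and \<phi> :: "real ^ 'n \<Rightarrow> real \<Rightarrow> real"
    and h :: "real ^ 'n \<Rightarrow> real \<Rightarrow> real ^ 'p"
    and g :: "real ^ 'n \<Rightarrow> real \<Rightarrow> real ^ 'm"
    and x :: "nat \<Rightarrow> real \<Rightarrow> real ^ 'n"
    and ut :: "nat \<Rightarrow> real \<Rightarrow> real ^ 'p"
    and vt :: "nat \<Rightarrow> real \<Rightarrow> real ^ 'm"
    and \<rho> :: "nat \<Rightarrow> real"
    and xbar :: "real \<Rightarrow> real ^ 'n"
  assumes "T > 0" and "M > 0" and "N > 0" and "\<gamma> > 1" and "\<rho>\<^sub>1 > 0" and "0 < \<tau>" and "\<tau> < 1"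
    and "alm_generated T h g M N \<gamma> \<rho>\<^sub>1 \<tau> x ut vt \<rho>"
    and "Linf T xbar"
    and "AE t in leb T. (\<lambda>k. x k t) \<longlonglongrightarrow> xbar t"
    and "\<exists>r>0. H1 T r xbar \<phi> \<and> H2 T r xbar h g"
    and "H3 T \<phi> h g x ut vt \<rho>"
    and "H4 T xbar \<phi> h g"
  shows "stationary_point T
           (\<lambda>y t. (\<Sum>i\<in>UNIV. (h y t $ i)\<^sup>2) + (\<Sum>j\<in>UNIV. (max (g y t $ j) 0)\<^sup>2)) xbar"
proof -
  let ?\<theta> = "\<lambda>t y. (\<Sum>i\<in>UNIV. (h y t $ i)\<^sup>2) + (\<Sum>j\<in>UNIV. (max (g y t $ j) 0)\<^sup>2)"
  note gen = assms(8) and conv = assms(10)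
  have phi_diff: "AE t in leb T. cont_diff (\<lambda>y. \<phi> y t)"
    and hg_diff: "AE t in leb T. cont_diff (\<lambda>y. (h y t, g y t))"
    using assms(11) by (auto simp: H1_def H2_def)
  have deriv_\<theta>: "(?\<theta> t has_derivative (\<lambda>w. 2 * ((\<Sum>i\<in>UNIV. h y t $ i * h' w $ i)
      + (\<Sum>j\<in>UNIV. max 0 (g y t $ j) * g' w $ j)))) (at y)"
    if "((\<lambda>y. h y t) has_derivative h') (at y)" "((\<lambda>y. g y t) has_derivative g') (at y)"
    for t y h' g'
    using has_derivative_add[OF has_derivative_sum_square[OF that(1), of "\<lambda>_. 0"]
        has_derivative_sum_max_0_square[OF that(2), of "\<lambda>_. 0"]]
    by (simp add: distrib_left max.commute)
  have "AE t in leb T. GDERIV (?\<theta> t) (xbar t) :> 0"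
    using gen \<open>\<gamma> > 1\<close> \<open>\<rho>\<^sub>1 > 0\<close>
  proof (cases rule: alm_penalty_cases)
    case bounded
    show ?thesis
      using alm_residual_tendsto_0[OF gen \<open>0 < \<tau>\<close> \<open>\<tau> < 1\<close> bounded] conv hg_diff
    proof eventually_elim
      case (elim t)
      obtain F where F: "\<And>y. ((\<lambda>y. (h y t, g y t)) has_derivative blinfun_apply (F y)) (at y)"
        using elim(3) unfolding cont_diff_def by blast
      have h': "((\<lambda>y. h y t) has_derivative (\<lambda>w. fst (F y w))) (at y)"
        and g': "((\<lambda>y. g y t) has_derivative (\<lambda>w. snd (F y w))) (at y)" for y
        using has_derivative_fst[OF F] has_derivative_snd[OF F] by simp_all
      have h_lim: "(\<lambda>k. h (x k t) t) \<longlonglongrightarrow> h (xbar t) t" and g_lim: "(\<lambda>k. g (x k t) t) \<longlonglongrightarrow> g (xbar t) t"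
        using elim(2) has_derivative_continuous[OF h'] has_derivative_continuous[OF g']
        by (auto intro: isCont_tendsto_compose)
      have h0: "h (xbar t) t = 0"
        using elim(1) h_lim LIMSEQ_unique by (auto simp: alm_H_def)
      \<comment> \<open>\<open>alm_V\<close> is a maximum with the g-value as one entry, also at
        index 0, so g along the iterates lies below a null sequence.\<close>
      have "g (xbar t) t $ j \<le> 0" for j
      proof (rule LIMSEQ_le)
        show "(\<lambda>k. g (x k t) t $ j) \<longlonglongrightarrow> g (xbar t) t $ j"
          using g_lim by (rule tendsto_vec_nth)
        show "(\<lambda>k. alm_V g x vt \<rho> k t $ j) \<longlonglongrightarrow> 0"
          using elim(1) tendsto_vec_nth by fastforce
      qed (auto simp: alm_V_def)
      then have "max 0 (g (xbar t) t $ j) = 0" for j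
        by (simp add: max_def order_antisym)
      \<comment> \<open>Each summand of the derivative carries a factor \<open>h\<close> or
        \<open>max 0 g\<close>, all of which vanish at the feasible point.\<close>
      with deriv_\<theta>[OF h' g', of "xbar t"] h0 show ?case
        by (simp add: gderiv_def)
    qed
  next
    case unbounded
    obtain e where weak: "weakly_null_L1 T e"
      and "\<forall>k\<ge>1. AE t in leb T.
        GDERIV (\<lambda>y. aug_lagrangian \<phi> h g (\<rho> k) y (ut k t) (vt k t) t) (x k t) :> e k t"
      using assms(12) unfolding H3_def by blast
    then have e: "AE t in leb T. \<forall>k\<ge>1.
        GDERIV (\<lambda>y. aug_lagrangian \<phi> h g (\<rho> k) y (ut k t) (vt k t) t) (x k t) :> e k t"
      by (simp add: AE_all_countable)
    have inv: "(\<lambda>k. inverse (\<rho> k)) \<longlonglongrightarrow> 0"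
      using unbounded by (rule tendsto_inverse_0_at_top)
    \<comment> \<open>Meant for the safeguarded multipliers, which are bounded from index 1 on while
      the penalty diverges.\<close>
    have small: "(\<lambda>k. c k / \<rho> k) \<longlonglongrightarrow> 0" if "\<And>k. 1 \<le> k \<Longrightarrow> \<bar>c k\<bar> \<le> B" for c B
    proof -
      have "(\<lambda>k. B * \<bar>inverse (\<rho> k)\<bar>) \<longlonglongrightarrow> 0"
        using tendsto_mult_right_zero[OF tendsto_rabs_zero[OF inv]] .
      moreover have "\<forall>\<^sub>F k in sequentially. norm (c k / \<rho> k) \<le> B * \<bar>inverse (\<rho> k)\<bar>"
        using eventually_ge_at_top[of "1::nat"]
        by eventually_elim (auto simp: that field_simps abs_mult divide_simps)
      ultimately show ?thesis
        by (rule Lim_null_comparison[rotated])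
    qed
    have limit: "AE t in leb T. \<exists>D. GDERIV (?\<theta> t) (xbar t) :> 2 *\<^sub>R D
        \<and> (\<lambda>k. inverse (\<rho> k) *\<^sub>R e k t) \<longlonglongrightarrow> D"
      using e conv phi_diff hg_diff alm_multiplier_eq_bounded[OF gen \<open>M > 0\<close>]
        alm_multiplier_ineq_bounded[OF gen \<open>N > 0\<close>]
    proof eventually_elim
      case (elim t)
      obtain P where P: "\<And>y. ((\<lambda>y. \<phi> y t) has_derivative blinfun_apply (P y)) (at y)"
        and P_cont: "\<And>w a. isCont (\<lambda>y. P y w) a"
        using elim(3) by (rule cont_diffE) (rule that)
      obtain F where F: "\<And>y. ((\<lambda>y. (h y t, g y t)) has_derivative blinfun_apply (F y)) (at y)"
        and F_cont: "\<And>w a. isCont (\<lambda>y. F y w) a"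
        using elim(4) by (rule cont_diffE) (rule that)
      have h': "((\<lambda>y. h y t) has_derivative (\<lambda>w. fst (F y w))) (at y)"
        and g': "((\<lambda>y. g y t) has_derivative (\<lambda>w. snd (F y w))) (at y)" for y
        using has_derivative_fst[OF F] has_derivative_snd[OF F] by simp_all
      have h_lim: "(\<lambda>k. h (x k t) t) \<longlonglongrightarrow> h (xbar t) t" and g_lim: "(\<lambda>k. g (x k t) t) \<longlonglongrightarrow> g (xbar t) t"
        using elim(2) has_derivative_continuous[OF h'] has_derivative_continuous[OF g']
        by (auto intro: isCont_tendsto_compose)
      have P_lim: "(\<lambda>k. P (x k t) w) \<longlonglongrightarrow> P (xbar t) w"
        and F_lim: "(\<lambda>k. F (x k t) w) \<longlonglongrightarrow> F (xbar t) w" for w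
        using elim(2) P_cont F_cont by (auto intro: isCont_tendsto_compose)
      have u_lim: "(\<lambda>k. ut k t $ i / \<rho> k) \<longlonglongrightarrow> 0" for i
        by (rule small[of _ M]) (use elim(5) in blast)
      have v_lim: "(\<lambda>k. vt k t $ j / \<rho> k) \<longlonglongrightarrow> 0" for j
        by (rule small[of _ N]) (use elim(6) in blast)
      \<comment> \<open>\<open>L\<close> is half the derivative of the infeasibility integrand at
        \<open>xbar t\<close>, and \<open>D\<close> the vector representing it.\<close>
      define L where "L w = (\<Sum>i\<in>UNIV. h (xbar t) t $ i * fst (F (xbar t) w) $ i)
          + (\<Sum>j\<in>UNIV. max 0 (g (xbar t) t $ j) * snd (F (xbar t) w) $ j)" for w
      define D where "D = (\<Sum>b\<in>Basis. L b *\<^sub>R b)"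
      have "GDERIV (?\<theta> t) (xbar t) :> 2 *\<^sub>R D"
        using has_derivative_imp_GDERIV[OF deriv_\<theta>[OF h' g', of "xbar t"]]
        by (simp add: D_def L_def scaleR_sum_right)
      moreover have "(\<lambda>k. inverse (\<rho> k) *\<^sub>R e k t) \<longlonglongrightarrow> D"
        unfolding tendsto_componentwise_iff[of _ D]
      proof
        fix b :: "real ^ 'n"
        assume b: "b \<in> Basis"
        \<comment> \<open>The penalty part of the derivative in direction b, already divided by
          \<open>\<rho> k\<close>.\<close>
        let ?L = "\<lambda>k. (\<Sum>i\<in>UNIV. (h (x k t) t $ i + ut k t $ i / \<rho> k) * fst (F (x k t) b) $ i)
          + (\<Sum>j\<in>UNIV. max 0 (g (x k t) t $ j + vt k t $ j / \<rho> k) * snd (F (x k t) b) $ j)"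
        have "?L \<longlonglongrightarrow> (\<Sum>i\<in>UNIV. (h (xbar t) t $ i + 0) * fst (F (xbar t) b) $ i)
          + (\<Sum>j\<in>UNIV. max 0 (g (xbar t) t $ j + 0) * snd (F (xbar t) b) $ j)"
          by (intro tendsto_add tendsto_sum tendsto_mult tendsto_max tendsto_const tendsto_vec_nth
              h_lim g_lim tendsto_fst[OF F_lim] tendsto_snd[OF F_lim] u_lim v_lim)
        then have "?L \<longlonglongrightarrow> L b"
          by (simp add: L_def)
        from tendsto_add[OF tendsto_mult[OF inv P_lim[of b]] this]
        have "(\<lambda>k. inverse (\<rho> k) * P (x k t) b + ?L k) \<longlonglongrightarrow> L b"
          by simp
        moreover have "\<forall>\<^sub>F k in sequentially. \<rho> k > 0"
          using unbounded by (simp add: filterlim_at_top_dense)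
        then have "\<forall>\<^sub>F k in sequentially.
            inverse (\<rho> k) * P (x k t) b + ?L k = inverse (\<rho> k) *\<^sub>R e k t \<bullet> b"
          using eventually_ge_at_top[of "1::nat"]
        proof eventually_elim
          case (elim k)
          \<comment> \<open>The gradient relation of \<open>H3\<close> is available since
            \<open>1 \<le> k\<close>; positivity of \<open>\<rho> k\<close> then permits the
            division.\<close>
          have "e k t \<bullet> b = P (x k t) b + \<rho> k * ?L k"
            using GDERIV_inner_eq[OF _ has_derivative_aug_lagrangian[where \<phi> = \<phi> and h = h and g = g
                  and t = t, OF P h' g']] \<open>1 \<le> k\<close>
              \<open>\<forall>k\<ge>1. GDERIV (\<lambda>y. aug_lagrangian \<phi> h g (\<rho> k) y (ut k t) (vt k t) t) (x k t) :> e k t\<close>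
            by blast
          with elim(1) show ?case
            by (simp add: field_simps)
        qed
        moreover have "D \<bullet> b = L b"
          using b by (simp add: D_def)
        ultimately show "(\<lambda>k. (inverse (\<rho> k) *\<^sub>R e k t) \<bullet> b) \<longlonglongrightarrow> D \<bullet> b"
          using tendsto_cong by fastforce
      qed
      ultimately show ?case by blast
    qed
    then have "AE t in leb T. convergent (\<lambda>k. inverse (\<rho> k) *\<^sub>R e k t)"
      by eventually_elim (auto simp: convergent_def)
    with weakly_null_L1_scaleR[OF weak inv]
    have "AE t in leb T. (\<lambda>k. inverse (\<rho> k) *\<^sub>R e k t) \<longlonglongrightarrow> 0"
      by (rule weakly_null_L1_AE_convergent)
    with limit show ?thesis
    proof eventually_elim
      case (elim t)
      then obtain D where D: "GDERIV (?\<theta> t) (xbar t) :> 2 *\<^sub>R D"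
        and lim: "(\<lambda>k. inverse (\<rho> k) *\<^sub>R e k t) \<longlonglongrightarrow> D"
        by blast
      have "D = 0"
        using lim elim(2) by (rule LIMSEQ_unique)
      with D show ?case
        by simp
    qed
  qed
  then show ?thesis
    using assms(9) by (simp add: stationary_point_def)
qed

end
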